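(* Under the hypotheses and notation of Theorem 1 (convex loss $\ell$, Gaussian measurements, $\varepsilon\in[0,1/2]$, $m/n\to\delta>1$ with bounded minimizer set, and $(\mu,\alpha,\lambda)$ the unique solution of the system with $\mu\ne0$), assume in addition that $\ell$ is continuously differentiable, and set $\sigma_\ell:=\alpha/\mu$. Then $$\sigma_\ell^2\,\mathcal{I}(\sigma_\ell G+SY)\ \ge\ \frac1\delta.$$
   Context: The system is: $\mathbb{E}[YS\,\mathcal{M}'_{\ell,1}(\alpha G+\mu SY;\lambda)]=0$, $\lambda^2\delta\,\mathbb{E}[(\mathcal{M}'_{\ell,1}(\alpha G+\mu SY;\lambda))^2]=\alpha^2$, $\lambda\delta\,\mathbb{E}[G\,\mathcal{M}'_{\ell,1}(\alpha G+\mu SY;\lambda)]=\alpha$, where $\mathcal{M}_\ell(x;\lambda)=\min_v\frac{1}{2\lambda}(x-v)^2+\ell(v)$ is the Moreau envelope and $\mathcal{M}'_{\ell,1}$ its derivative in $x$; $G,S$ i.i.d. $\mathcal{N}(0,1)$, $Y=\mathrm{BSC}_\varepsilon(\mathrm{sign}(S))$, i.e. $Y=\mathrm{sign}(S)$ w.p. $1-\varepsilon$ and $-\mathrm{sign}(S)$ w.p. $\varepsilon$, independently. For a random variable $H$ with differentiable density $p_H$, its Fisher information is $\mathcal{I}(H)=\mathbb{E}[(p_H'(H)/p_H(H))^2]$. *)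

theory Defs
  imports "HOL-Probability.Probability"
begin

definition moreau :: "(real \<Rightarrow> real) \<Rightarrow> real \<Rightarrow> real \<Rightarrow> real" where
  "moreau l lam x = (INF v. (x - v)^2 / (2 * lam) + l v)"

definition moreau_d1 :: "(real \<Rightarrow> real) \<Rightarrow> real \<Rightarrow> real \<Rightarrow> real" where
  "moreau_d1 l lam x = deriv (\<lambda>z. moreau l lam z) x"

text \<open>Expectation over (G,S,Y): G,S iid N(0,1), Y = sign S w.p. 1-eps and
  -sign S w.p. eps, independently (real-valued, Bochner integral).\<close>
definition E_GSY :: "real \<Rightarrow> (real \<Rightarrow> real \<Rightarrow> real \<Rightarrow> real) \<Rightarrow> real" where
  "E_GSY eps f = (LINT g|lborel. LINT s|lborel.
      std_normal_density g * std_normal_density s *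
      ((1 - eps) * f g s (sgn s) + eps * f g s (- sgn s)))"

definition En_GSY :: "real \<Rightarrow> (real \<Rightarrow> real \<Rightarrow> real \<Rightarrow> real) \<Rightarrow> ennreal" where
  "En_GSY eps f = (\<integral>\<^sup>+ g. \<integral>\<^sup>+ s.
      ennreal (std_normal_density g * std_normal_density s *
      ((1 - eps) * f g s (sgn s) + eps * f g s (- sgn s))) \<partial>lborel \<partial>lborel)"

definition system_eqs :: "(real \<Rightarrow> real) \<Rightarrow> real \<Rightarrow> real \<Rightarrow> real \<Rightarrow> real \<Rightarrow> real \<Rightarrow> bool" where
  "system_eqs l eps delta mu alpha lam \<longleftrightarrow>
     E_GSY eps (\<lambda>g s y. y * s * moreau_d1 l lam (alpha * g + mu * s * y)) = 0 \<and>
     lam^2 * delta * E_GSY eps (\<lambda>g s y. (moreau_d1 l lam (alpha * g + mu * s * y))^2) = alpha^2 \<and>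
     lam * delta * E_GSY eps (\<lambda>g s y. g * moreau_d1 l lam (alpha * g + mu * s * y)) = alpha"

definition is_density_H :: "real \<Rightarrow> real \<Rightarrow> (real \<Rightarrow> real) \<Rightarrow> bool" where
  "is_density_H eps sig p \<longleftrightarrow> (\<forall>h. 0 \<le> p h) \<and> p \<in> borel_measurable borel \<and>
     (\<forall>A \<in> sets borel. E_GSY eps (\<lambda>g s y. indicator A (sig * g + s * y))
                        = (LINT x:A|lborel. p x))"

definition fisher_H :: "real \<Rightarrow> real \<Rightarrow> (real \<Rightarrow> real) \<Rightarrow> ennreal" where
  "fisher_H eps sig p = En_GSY eps (\<lambda>g s y. (deriv p (sig * g + s * y) / p (sig * g + s * y))^2)"

end

theory Submission
  imports Defs
begin

text \<open>Write \<open>\<sigma> = \<alpha>/\<mu>\<close>, \<open>H = \<sigma>G + SY\<close>, and let \<open>F(h)\<close> be the derivative of the Moreau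
  envelope at \<open>\<mu>h\<close>. As \<open>\<sigma>G\<close> is Gaussian, the density \<open>p\<close> of \<open>H\<close> satisfies
  \<open>E[G | H] = - \<sigma> p'(H)/p(H)\<close>, so that \<open>E[G F(H)] = - \<sigma> E[F(H) p'(H)/p(H)]\<close>. The second and third
  equations of the system give \<open>E[F(H)\<^sup>2] = \<alpha>\<^sup>2/(\<lambda>\<^sup>2\<delta>)\<close> and \<open>E[G F(H)] = \<alpha>/(\<lambda>\<delta>)\<close>, and the
  Cauchy-Schwarz inequality yields the bound.\<close>

section \<open>Regularity of the Moreau envelope and of its derivative\<close>

text \<open>Dividing by \<open>y - x\<close> leaves an error of order
  \<open>\<bar>y - x\<bar>\<close>. This form of differentiability serves the envelope and the
  density of \<open>H\<close>, and spares an interchange of limit with infimum or integral.\<close>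

lemma DERIV_from_quadratic_bound:
  fixes f :: "real \<Rightarrow> real"
  assumes "\<And>y. \<bar>f y - f x - d * (y - x)\<bar> \<le> C * (y - x)\<^sup>2"
  shows "(f has_real_derivative d) (at x)"
  unfolding has_field_derivative_iff
proof (rule LIM_zero_cancel, rule Lim_null_comparison)
  show "\<forall>\<^sub>F y in at x. norm ((f y - f x) / (y - x) - d) \<le> C * \<bar>y - x\<bar>"
  proof (rule eventually_at_topological[THEN iffD2], intro exI[of _ UNIV] conjI ballI impI)
    fix y assume "y \<noteq> x"
    then have "norm ((f y - f x) / (y - x) - d) = \<bar>f y - f x - d * (y - x)\<bar> / \<bar>y - x\<bar>"
      by (simp add: divide_simps flip: abs_divide)
    also have "\<dots> \<le> C * (y - x)\<^sup>2 / \<bar>y - x\<bar>"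
      using assms by (intro divide_right_mono) auto
    also have "\<dots> = C * \<bar>y - x\<bar>"
      using \<open>y \<noteq> x\<close> by (simp add: divide_simps power2_eq_square)
    finally show "norm ((f y - f x) / (y - x) - d) \<le> C * \<bar>y - x\<bar>" .
  qed auto
  have "((\<lambda>y. C * \<bar>y - x\<bar>) \<longlongrightarrow> C * \<bar>x - x\<bar>) (at x)"
    by (intro tendsto_intros)
  then show "((\<lambda>y. C * \<bar>y - x\<bar>) \<longlongrightarrow> 0) (at x)" by simp
qed

text \<open>The equation is the stationarity condition of
  \<open>(x - v)^2 / (2 * lam) + l v\<close>, so \<open>v\<close> is the proximal point of
  \<open>x\<close>. Convexity makes \<open>l'\<close> monotone, and the intermediate value theorem
  applies.\<close>

lemma prox_exists:
  fixes l l' :: "real \<Rightarrow> real"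
  assumes convex: "convex_on UNIV l"
    and l': "continuous_on UNIV l'" "\<And>x. (l has_real_derivative l' x) (at x)"
    and lam: "lam > 0"
  obtains v where "v + lam * l' v = x"
proof -
  have tangent: "l y - l z \<ge> l' z * (y - z)" for y z
    using convex_on_imp_above_tangent[OF convex, of z y "l' z"] l'(2) by simp
  have mono: "l' z \<le> l' y" if "z \<le> y" for y z
  proof (cases "z = y")
    case False
    with that have "z < y" by simp
    have "l' z * (y - z) \<le> l' y * (y - z)"
      using tangent[of z y] tangent[of y z] by (simp add: algebra_simps)
    with \<open>z < y\<close> show ?thesis by simp
  qed simp
  \<comment> \<open>Chosen so that \<open>x\<close> lies between \<open>- b + lam * l' 0\<close> and
    \<open>b + lam * l' 0\<close>; monotonicity of \<open>l'\<close> then makes \<open>- b\<close>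
    and \<open>b\<close> bracket the solution.\<close>
  define b where "b = \<bar>x\<bar> + \<bar>lam * l' 0\<bar>"
  have "b \<ge> 0" by (simp add: b_def)
  have "lam * l' (- b) \<le> lam * l' 0" "lam * l' 0 \<le> lam * l' b"
    using mono lam \<open>b \<ge> 0\<close> by simp_all
  then have "- b + lam * l' (- b) \<le> x" "x \<le> b + lam * l' b"
    by (auto simp: b_def)
  moreover have "continuous_on {- b..b} (\<lambda>v. v + lam * l' v)"
    using l'(1) by (intro continuous_intros) (auto intro: continuous_on_subset)
  ultimately have "\<exists>v\<ge>- b. v \<le> b \<and> v + lam * l' v = x"
    using \<open>b \<ge> 0\<close> by (intro IVT') auto
  then show thesis using that by blast
qed

text \<open>The slope is \<open>c = l' v\<close> at the proximal point \<open>v\<close> of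
  \<open>x\<close>. Replacing \<open>l\<close> by its tangent at \<open>v\<close> bounds the
  envelope from below; keeping \<open>v\<close> as competitor at \<open>y\<close> bounds it from
  above.\<close>

lemma moreau_first_order_bounds:
  fixes l l' :: "real \<Rightarrow> real"
  assumes convex: "convex_on UNIV l"
    and l': "continuous_on UNIV l'" "\<And>x. (l has_real_derivative l' x) (at x)"
    and lam: "lam > 0"
  shows "\<exists>c. \<forall>y. 0 \<le> moreau l lam y - moreau l lam x - c * (y - x) \<and>
    moreau l lam y - moreau l lam x - c * (y - x) \<le> (y - x)\<^sup>2 / (2 * lam)"
proof -
  obtain v where v: "v + lam * l' v = x"
    using prox_exists[OF assms] .
  define c where "c = l' v"
  have vx: "v = x - lam * c" using v by (simp add: c_def)
  have lower: "l v + lam * c\<^sup>2 / 2 + c * (y - x) \<le> (y - u)\<^sup>2 / (2 * lam) + l u" for y u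
  proof -
    have "l u \<ge> l v + c * (u - v)"
      using convex_on_imp_above_tangent[OF convex, of v u "l' v"] l'(2) by (simp add: c_def)
    \<comment> \<open>Completing the square: the gap left by the tangent bound is a perfect
      square.\<close>
    moreover have "(y - u)\<^sup>2 / (2 * lam) + c * (u - v) - (lam * c\<^sup>2 / 2 + c * (y - x))
        = (y - u - lam * c)\<^sup>2 / (2 * lam)"
      using lam by (simp add: vx field_simps power2_eq_square)
    moreover have "(y - u - lam * c)\<^sup>2 / (2 * lam) \<ge> 0" using lam by simp
    ultimately show ?thesis by linarith
  qed
  have upper: "moreau l lam y \<le> (y - v)\<^sup>2 / (2 * lam) + l v" for y
    unfolding moreau_def
    by (rule cINF_lower) (auto intro!: bdd_belowI2[OF lower])
  have ge: "l v + lam * c\<^sup>2 / 2 + c * (y - x) \<le> moreau l lam y" for y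
    unfolding moreau_def by (rule cINF_greatest) (auto intro: lower)
  have "(x - v)\<^sup>2 / (2 * lam) = lam * c\<^sup>2 / 2"
    using lam by (simp add: vx power2_eq_square)
  then have eq: "moreau l lam x = l v + lam * c\<^sup>2 / 2"
    using upper[of x] ge[of x] by simp
  have "0 \<le> moreau l lam y - moreau l lam x - c * (y - x)" for y
    using ge[of y] eq by simp
  moreover have "moreau l lam y - moreau l lam x - c * (y - x) \<le> (y - x)\<^sup>2 / (2 * lam)" for y
  proof -
    have "(y - v)\<^sup>2 / (2 * lam) = lam * c\<^sup>2 / 2 + c * (y - x) + (y - x)\<^sup>2 / (2 * lam)"
      using lam by (simp add: vx field_simps power2_eq_square)
    then show ?thesis using upper[of y] eq by simp
  qed
  ultimately show ?thesis by blast
qed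

text \<open>The first-order bounds identify the derivative. Adding them for \<open>(x, y)\<close>
  and \<open>(y, x)\<close> cancels the envelope values and traps
  \<open>(?d x - ?d y) * (x - y)\<close> between \<open>0\<close> and
  \<open>(x - y)^2 / lam\<close>.\<close>

lemma moreau_d1_lipschitz:
  fixes l :: "real \<Rightarrow> real"
  assumes convex: "convex_on UNIV l"
    and C1: "\<exists>l'. continuous_on UNIV l' \<and> (\<forall>x. (l has_real_derivative l' x) (at x))"
    and lam: "lam > 0"
  shows "(1 / lam)-lipschitz_on UNIV (moreau_d1 l lam)"
proof -
  let ?M = "moreau l lam" and ?d = "moreau_d1 l lam"
  have bounds: "0 \<le> ?M y - ?M x - ?d x * (y - x) \<and> ?M y - ?M x - ?d x * (y - x) \<le> (y - x)\<^sup>2 / (2 * lam)" for x y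
  proof -
    obtain c where c: "\<And>y. 0 \<le> ?M y - ?M x - c * (y - x)"
        "\<And>y. ?M y - ?M x - c * (y - x) \<le> (y - x)\<^sup>2 / (2 * lam)"
      using moreau_first_order_bounds[OF convex _ _ lam, of _ x] C1 by meson
    have "(?M has_real_derivative c) (at x)"
      by (rule DERIV_from_quadratic_bound[where C = "1 / (2 * lam)"]) (use c in simp)
    then have "?d x = c" by (simp add: moreau_d1_def DERIV_imp_deriv)
    with c show ?thesis by simp
  qed
  show ?thesis
  proof (rule lipschitz_onI)
    fix x y :: real
    have "0 \<le> (?d x - ?d y) * (x - y)" "(?d x - ?d y) * (x - y) \<le> (x - y)\<^sup>2 / lam"
      using bounds[of y x] bounds[of x y] by (simp_all add: algebra_simps power2_commute[of y x])
    then have "\<bar>?d x - ?d y\<bar> * \<bar>x - y\<bar> \<le> (\<bar>x - y\<bar> / lam) * \<bar>x - y\<bar>"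
      by (simp add: power2_eq_square flip: abs_mult)
    from mult_right_le_imp_le[OF this]
    show "dist (?d x) (?d y) \<le> 1 / lam * dist x y"
      by (cases "x = y") (simp_all add: dist_real_def)
  qed (use lam in simp)
qed

section \<open>The law of \<open>SY\<close>\<close>

text \<open>\<open>SY\<close> equals \<open>\<bar>S\<bar>\<close> with probability
  \<open>1 - eps\<close> and \<open>- \<bar>S\<bar>\<close> otherwise, so its density is the normal
  one times \<open>2 * (1 - eps)\<close> on the right half-line and \<open>2 * eps\<close> on the
  left.\<close>

definition SY_density :: "real \<Rightarrow> real \<Rightarrow> real" where
  "SY_density eps w = std_normal_density w * (1 + (1 - 2 * eps) * sgn w)"

lemma SY_density_measurable [measurable]: "SY_density eps \<in> borel_measurable borel"
  unfolding SY_density_def by measurable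

lemma std_normal_density_minus [simp]: "std_normal_density (- x) = std_normal_density x"
  by (simp add: std_normal_density_def)

lemma SY_density_bounds:
  assumes "0 \<le> eps" "eps \<le> 1 / 2"
  shows "0 \<le> SY_density eps w" "SY_density eps w \<le> 2 * std_normal_density w"
proof -
  have "0 \<le> 1 + (1 - 2 * eps) * sgn w" "1 + (1 - 2 * eps) * sgn w \<le> 2"
    using assms by (auto simp: sgn_if)
  then show "0 \<le> SY_density eps w" "SY_density eps w \<le> 2 * std_normal_density w"
    using mult_left_mono[OF _ normal_density_nonneg, of "1 + (1 - 2 * eps) * sgn w" 2 0 1 w]
    by (auto simp: SY_density_def mult.commute)
qed

lemma SY_density_moment_integrable:
  assumes "0 \<le> eps" "eps \<le> 1 / 2"
  shows "integrable lborel (\<lambda>w. SY_density eps w * w ^ k)"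
proof (rule Bochner_Integration.integrable_bound)
  show "integrable lborel (\<lambda>w. 2 * (std_normal_density w * w ^ k))"
    by (intro integrable_mult_right integrable_std_normal_moment)
  show "AE w in lborel. norm (SY_density eps w * w ^ k) \<le> norm (2 * (std_normal_density w * w ^ k))"
    using SY_density_bounds[OF assms] mult_right_mono[of "SY_density eps w" "2 * std_normal_density w" "\<bar>w ^ k\<bar>" for w]
    by (intro AE_I2) (simp add: abs_mult mult.assoc)
qed measurable

text \<open>Averaging the density of \<open>SY\<close> over \<open>w\<close> and \<open>-w\<close> recovers the mixture over the two
  values of \<open>Y\<close> in terms of \<open>S\<close>.\<close>

lemma SY_density_symmetrize:
  "SY_density eps s * f s + SY_density eps (- s) * f (- s) =
     2 * (std_normal_density s * ((1 - eps) * f (s * sgn s) + eps * f (s * - sgn s)))"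
  by (cases s "0 :: real" rule: linorder_cases) (simp_all add: SY_density_def algebra_simps)

text \<open>Reflection preserves Lebesgue measure, so both halves of the symmetrized integrand have
  the same integral; integrability allows the sum to be split.\<close>

lemma SY_expectation:
  assumes "integrable lborel (\<lambda>w. SY_density eps w * f w)"
  shows "(LINT s|lborel. std_normal_density s * ((1 - eps) * f (s * sgn s) + eps * f (s * - sgn s)))
    = (LINT w|lborel. SY_density eps w * f w)"
proof -
  let ?F = "\<lambda>w. SY_density eps w * f w"
  have "integrable lborel (\<lambda>w. ?F (- w))"
    using lborel_integrable_real_affine[OF assms, of "-1" 0] by simp
  moreover have "(LINT w|lborel. ?F (- w)) = integral\<^sup>L lborel ?F"
    using lborel_integral_real_affine[of "-1" ?F 0] by simp
  ultimately have "(LINT w|lborel. ?F w + ?F (- w)) = 2 * integral\<^sup>L lborel ?F"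
    using assms by simp
  then show ?thesis by (simp add: SY_density_symmetrize)
qed

text \<open>The same reflection argument for integrals that may be infinite, as needed for the
  Fisher information.\<close>

lemma SY_nn_expectation:
  assumes eps: "0 \<le> eps" "eps \<le> 1 / 2"
    and f: "\<And>w. 0 \<le> f w" and [measurable]: "f \<in> borel_measurable borel"
  shows "(\<integral>\<^sup>+s. ennreal (std_normal_density s * ((1 - eps) * f (s * sgn s) + eps * f (s * - sgn s))) \<partial>lborel)
    = (\<integral>\<^sup>+w. ennreal (SY_density eps w * f w) \<partial>lborel)" (is "?L = ?R")
proof -
  let ?F = "\<lambda>w. SY_density eps w * f w"
  have pos: "0 \<le> ?F w" for w
    using f SY_density_bounds[OF eps] by simp
  have "?R = (\<integral>\<^sup>+w. ennreal (?F (- w)) \<partial>lborel)"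
    using nn_integral_real_affine[of "\<lambda>w. ennreal (?F w)" "-1" 0] by simp
  then have "2 * ?R = ?R + (\<integral>\<^sup>+w. ennreal (?F (- w)) \<partial>lborel)"
    by (simp add: mult_2)
  also have "\<dots> = (\<integral>\<^sup>+w. ennreal (?F w + ?F (- w)) \<partial>lborel)"
    using pos by (simp add: nn_integral_add)
  also have "\<dots> = 2 * ?L"
    unfolding SY_density_symmetrize using f eps
    by (subst nn_integral_cmult[symmetric]) (auto simp: ennreal_mult')
  finally show ?thesis
    by (simp add: ennreal_mult_cancel_left)
qed

section \<open>Expectations of functions of \<open>G\<close> and \<open>H\<close> as integrals over
  the values of \<open>H\<close>\<close>

text \<open>The density of \<open>H = sig G + SY\<close> multiplied by \<open>E[c(G) | H = h]\<close>; for \<open>c = 1\<close> it is the density itself.\<close>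

definition H_weight :: "real \<Rightarrow> real \<Rightarrow> (real \<Rightarrow> real) \<Rightarrow> real \<Rightarrow> real" where
  "H_weight eps sig c h = (LINT g|lborel. c g * (std_normal_density g * SY_density eps (h - sig * g)))"

lemma lborel_integral_shift:
  fixes f :: "real \<Rightarrow> real"
  shows "(LINT x|lborel. f (x + t)) = integral\<^sup>L lborel f"
  using lborel_integral_real_affine[of 1 f t] by (simp add: add.commute)

lemma lborel_integrable_shift:
  fixes f :: "real \<Rightarrow> real"
  shows "integrable lborel (\<lambda>x. f (x + t)) \<longleftrightarrow> integrable lborel f"
  using lborel_integrable_real_affine_iff[of 1 f t] by (simp add: add.commute)

text \<open>For fixed \<open>g\<close>, substitute \<open>h = sig * g + w\<close>, then exchange the
  integrals by Fubini. Quadratic growth suffices for absolute integrability, since \<open>G\<close>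
  and \<open>SY\<close> have finite second moments.\<close>

lemma H_expectation:
  fixes c K :: "real \<Rightarrow> real"
  assumes eps: "0 \<le> eps" "eps \<le> 1 / 2"
    and [measurable]: "c \<in> borel_measurable borel" "K \<in> borel_measurable borel"
    and growth: "\<And>g w. \<bar>c g * K (sig * g + w)\<bar> \<le> C * (1 + g\<^sup>2 + w\<^sup>2)"
  shows "integrable lborel (\<lambda>h. K h * H_weight eps sig c h)" (is ?I)
    and "E_GSY eps (\<lambda>g s y. c g * K (sig * g + s * y)) = (LINT h|lborel. K h * H_weight eps sig c h)" (is ?E)
proof -
  let ?k = "\<lambda>g w. SY_density eps w * (c g * K (sig * g + w))"
  \<comment> \<open>The integrand in the coordinates \<open>(g, h)\<close>: integrating over
    \<open>h\<close> first gives the expectation, over \<open>g\<close> first the weight.\<close>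
  let ?F = "\<lambda>(g, h). std_normal_density g * ?k g (h - sig * g)"
  note nonneg = SY_density_bounds(1)[OF eps]
  note mom = SY_density_moment_integrable[OF eps]
  have C: "0 \<le> C" using growth[of 0 0] by simp
  define m0 m2 where "m0 = (LINT w|lborel. SY_density eps w)" and "m2 = (LINT w|lborel. SY_density eps w * w\<^sup>2)"
  have dom: "\<bar>?k g w\<bar> \<le> C * (1 + g\<^sup>2) * SY_density eps w + C * (SY_density eps w * w\<^sup>2)" for g w
    using mult_left_mono[OF growth[of g w] nonneg[of w]] nonneg[of w]
    by (simp add: abs_mult algebra_simps)
  have int_dom: "integrable lborel (\<lambda>w. C * (1 + g\<^sup>2) * SY_density eps w + C * (SY_density eps w * w\<^sup>2))" for g
    using mom[of 0] mom[of 2] by simp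
  have int_k: "integrable lborel (?k g)" for g
    by (rule Bochner_Integration.integrable_bound[OF int_dom[of g]])
      (auto intro!: order_trans[OF dom abs_ge_self])
  have int_F: "integrable lborel (\<lambda>h. ?F (g, h))" for g
    using lborel_integrable_shift[of "?k g" "- sig * g"] int_k[of g] by simp
  have abs_F: "(LINT h|lborel. norm (?F (g, h))) = std_normal_density g * (LINT w|lborel. \<bar>?k g w\<bar>)" for g
    using lborel_integral_shift[of "\<lambda>w. \<bar>?k g w\<bar>" "- sig * g"] by (simp add: abs_mult)
  have F_meas [measurable]: "?F \<in> borel_measurable (lborel \<Otimes>\<^sub>M lborel)"
    by measurable
  have prod: "integrable (lborel \<Otimes>\<^sub>M lborel) ?F"
  proof (rule lborel_pair.Fubini_integrable)
    have bound: "(LINT w|lborel. \<bar>?k g w\<bar>) \<le> C * (1 + g\<^sup>2) * m0 + C * m2" for g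
    proof -
      have "(LINT w|lborel. \<bar>?k g w\<bar>) \<le>
          (LINT w|lborel. C * (1 + g\<^sup>2) * SY_density eps w + C * (SY_density eps w * w\<^sup>2))"
        by (intro integral_mono integrable_abs int_k int_dom dom)
      then show ?thesis using mom[of 0] mom[of 2] by (simp add: m0_def m2_def)
    qed
    \<comment> \<open>The bound on the inner integral, regrouped into the zeroth and second Gaussian
      moments.\<close>
    have *: "integrable lborel (\<lambda>g. C * (m0 + m2) * (std_normal_density g * g ^ 0) + C * m0 * (std_normal_density g * g ^ 2))"
      by (intro Bochner_Integration.integrable_add integrable_mult_right integrable_std_normal_moment)
    show "integrable lborel (\<lambda>g. LINT h|lborel. norm (?F (g, h)))"
    proof (rule Bochner_Integration.integrable_bound[OF *])
      show "(\<lambda>g. LINT h|lborel. norm (?F (g, h))) \<in> borel_measurable lborel"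
        by measurable
      show "AE g in lborel. norm (LINT h|lborel. norm (?F (g, h)))
          \<le> norm (C * (m0 + m2) * (std_normal_density g * g ^ 0) + C * m0 * (std_normal_density g * g ^ 2))"
      proof (rule AE_I2)
        fix g
        have "norm (LINT h|lborel. norm (?F (g, h))) = std_normal_density g * (LINT w|lborel. \<bar>?k g w\<bar>)"
          unfolding abs_F by (simp add: abs_mult)
        also have "\<dots> \<le> std_normal_density g * (C * (1 + g\<^sup>2) * m0 + C * m2)"
          by (intro mult_left_mono bound) simp
        also have "\<dots> = C * (m0 + m2) * (std_normal_density g * g ^ 0) + C * m0 * (std_normal_density g * g ^ 2)"
          by (simp add: algebra_simps)
        finally show "norm (LINT h|lborel. norm (?F (g, h)))
          \<le> norm (C * (m0 + m2) * (std_normal_density g * g ^ 0) + C * m0 * (std_normal_density g * g ^ 2))"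
          by simp
      qed
    qed
  qed (use int_F in auto)
  have inner: "(LINT g|lborel. ?F (g, h)) = K h * H_weight eps sig c h" for h
    unfolding H_weight_def by (subst integral_mult_right_zero[symmetric]) (simp add: mult_ac)
  show ?I
    using lborel_pair.integrable_snd[of "\<lambda>g h. ?F (g, h)"] prod unfolding inner by simp
  have "E_GSY eps (\<lambda>g s y. c g * K (sig * g + s * y)) =
      (LINT g|lborel. std_normal_density g * (LINT s|lborel. std_normal_density s *
        ((1 - eps) * (c g * K (sig * g + s * sgn s)) + eps * (c g * K (sig * g + s * - sgn s)))))"
    unfolding E_GSY_def by (simp only: mult.assoc integral_mult_right_zero)
  also have "\<dots> = (LINT g|lborel. std_normal_density g * (LINT w|lborel. ?k g w))"
    by (intro Bochner_Integration.integral_cong refl arg_cong2[where f = "(*)"] SY_expectation int_k)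
  also have "\<dots> = (LINT g|lborel. LINT h|lborel. ?F (g, h))"
    using lborel_integral_shift[of "?k g" "- sig * g" for g] by simp
  also have "\<dots> = (LINT h|lborel. LINT g|lborel. ?F (g, h))"
    using lborel_pair.Fubini_integral[of "\<lambda>g h. ?F (g, h)"] prod by simp
  also have "\<dots> = (LINT h|lborel. K h * H_weight eps sig c h)"
    unfolding inner ..
  finally show ?E .
qed

text \<open>The nonnegative version of the same change of variables: Tonelli replaces Fubini, so no
  growth condition on \<open>K\<close> appears.\<close>

lemma En_GSY_H:
  fixes K :: "real \<Rightarrow> real"
  assumes eps: "0 \<le> eps" "eps \<le> 1 / 2"
    and [measurable]: "K \<in> borel_measurable borel" and K: "\<And>h. 0 \<le> K h"
  shows "En_GSY eps (\<lambda>g s y. K (sig * g + s * y)) =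
    (\<integral>\<^sup>+h. ennreal (K h) * (\<integral>\<^sup>+g. ennreal (std_normal_density g * SY_density eps (h - sig * g)) \<partial>lborel) \<partial>lborel)"
proof -
  note nonneg = SY_density_bounds(1)[OF eps]
  have "En_GSY eps (\<lambda>g s y. K (sig * g + s * y)) =
      (\<integral>\<^sup>+g. ennreal (std_normal_density g) * (\<integral>\<^sup>+s. ennreal (std_normal_density s *
        ((1 - eps) * K (sig * g + s * sgn s) + eps * K (sig * g + s * - sgn s))) \<partial>lborel) \<partial>lborel)"
    unfolding En_GSY_def using eps K
    by (simp add: nn_integral_cmult[symmetric] ennreal_mult'[symmetric] mult.assoc)
  also have "\<dots> = (\<integral>\<^sup>+g. ennreal (std_normal_density g) *
      (\<integral>\<^sup>+w. ennreal (SY_density eps w * K (sig * g + w)) \<partial>lborel) \<partial>lborel)"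
    using K by (intro nn_integral_cong arg_cong2[where f = "(*)"] refl SY_nn_expectation eps) auto
  also have "\<dots> = (\<integral>\<^sup>+g. ennreal (std_normal_density g) *
      (\<integral>\<^sup>+h. ennreal (SY_density eps (h - sig * g) * K h) \<partial>lborel) \<partial>lborel)"
    using nn_integral_real_affine[of "\<lambda>w. ennreal (SY_density eps w * K (sig * g + w))" 1 "- sig * g" for g]
    by simp
  also have "\<dots> = (\<integral>\<^sup>+g. \<integral>\<^sup>+h. ennreal (K h) *
      ennreal (std_normal_density g * SY_density eps (h - sig * g)) \<partial>lborel \<partial>lborel)"
    using K nonneg
    by (simp add: nn_integral_cmult[symmetric] ennreal_mult'[symmetric] mult_ac)
  also have "\<dots> = (\<integral>\<^sup>+h. \<integral>\<^sup>+g. ennreal (K h) *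
      ennreal (std_normal_density g * SY_density eps (h - sig * g)) \<partial>lborel \<partial>lborel)"
    by (rule lborel_pair.Fubini') measurable
  finally show ?thesis by (simp add: nn_integral_cmult)
qed

section \<open>Uniform bounds for the Gaussian density and its Taylor remainder\<close>

lemma std_normal_density_le: "std_normal_density x \<le> exp (- x\<^sup>2 / 2)"
proof -
  have "1 \<le> sqrt (2 * pi)" using pi_ge_two by simp
  then show ?thesis by (simp add: std_normal_density_def field_simps)
qed

lemma std_normal_density_le_1: "std_normal_density x \<le> 1"
  using std_normal_density_le[of x] by (rule order_trans) simp

text \<open>From \<open>1 + t \<le> exp t\<close> at \<open>t = x^2 / 2\<close>; it controls the
  first two derivatives of the density.\<close>

lemma quadratic_std_normal_density_le: "(1 + x\<^sup>2 / 2) * std_normal_density x \<le> 1"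
proof -
  have "(1 + x\<^sup>2 / 2) * std_normal_density x \<le> exp (x\<^sup>2 / 2) * exp (- x\<^sup>2 / 2)"
    by (intro mult_mono std_normal_density_le) auto
  then show ?thesis by (simp flip: exp_add)
qed

lemma std_normal_density_DERIV:
  "(std_normal_density has_real_derivative - x * std_normal_density x) (at x)"
  unfolding std_normal_density_def by (auto intro!: derivative_eq_intros simp: field_simps)

lemma std_normal_density_DERIV2:
  "((\<lambda>x. - x * std_normal_density x) has_real_derivative (x\<^sup>2 - 1) * std_normal_density x) (at x)"
  by (auto intro!: derivative_eq_intros std_normal_density_DERIV simp: algebra_simps power2_eq_square)

text \<open>The second derivative is bounded by \<open>2\<close>, and the mean value inequality is
  used twice. The constant is uniform in \<open>x\<close>, so the bound survives integration against
  the law of \<open>SY\<close>.\<close>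

lemma std_normal_density_taylor:
  "\<bar>std_normal_density y - std_normal_density x + x * std_normal_density x * (y - x)\<bar> \<le> 2 * (y - x)\<^sup>2"
proof -
  have second: "\<bar>(z\<^sup>2 - 1) * std_normal_density z\<bar> \<le> 2" for z
  proof -
    have "\<bar>z\<^sup>2 - 1\<bar> * std_normal_density z \<le> (2 * (1 + z\<^sup>2 / 2)) * std_normal_density z"
      using zero_le_power2[of z] by (intro mult_right_mono) (auto simp: abs_if simp del: zero_le_power2)
    also have "\<dots> \<le> 2"
      using quadratic_std_normal_density_le[of z] by (simp only: mult.assoc)
    finally show ?thesis by (simp add: abs_mult)
  qed
  have first: "\<bar>- z * std_normal_density z - - x * std_normal_density x\<bar> \<le> 2 * \<bar>z - x\<bar>" for z
    using field_differentiable_bound[where S = UNIV and f = "\<lambda>x. - x * std_normal_density x"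
        and f' = "\<lambda>x. (x\<^sup>2 - 1) * std_normal_density x" and B = 2 and x = z and y = x]
      second std_normal_density_DERIV2 by auto
  \<comment> \<open>The mean value inequality for the density minus its linear part at
    \<open>x\<close>: the derivative vanishes at \<open>x\<close> and is at most
    \<open>2 * \<bar>y - x\<bar>\<close> on the segment.\<close>
  have "norm ((std_normal_density y + x * std_normal_density x * y) -
      (std_normal_density x + x * std_normal_density x * x)) \<le> (2 * \<bar>y - x\<bar>) * norm (y - x)"
  proof (rule field_differentiable_bound[where S = "closed_segment x y"
        and f' = "\<lambda>z. - z * std_normal_density z + x * std_normal_density x"])
    fix z assume z: "z \<in> closed_segment x y"
    show "((\<lambda>z. std_normal_density z + x * std_normal_density x * z) has_real_derivative
        - z * std_normal_density z + x * std_normal_density x) (at z within closed_segment x y)"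
      by (auto intro!: derivative_eq_intros has_field_derivative_at_within[OF std_normal_density_DERIV])
    have "\<bar>z - x\<bar> \<le> \<bar>y - x\<bar>"
      using z by (auto simp: closed_segment_eq_real_ivl split: if_splits)
    then show "norm (- z * std_normal_density z + x * std_normal_density x) \<le> 2 * \<bar>y - x\<bar>"
      using first[of z] by simp
  qed auto
  then show ?thesis by (simp add: algebra_simps power2_eq_square flip: abs_mult)
qed

section \<open>Differentiability of the density of \<open>H\<close>\<close>

text \<open>The substitution \<open>w = h - sig * g\<close> moves \<open>h\<close> out of
  \<open>SY_density\<close>, which may jump at \<open>0\<close>, into the smooth Gaussian
  factor.\<close>

lemma H_weight_convolution:
  assumes "sig \<noteq> 0"
  shows "H_weight eps sig c h =
    (LINT w|lborel. c ((h - w) / sig) * std_normal_density ((h - w) / sig) * SY_density eps w) / \<bar>sig\<bar>"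
proof -
  have *: "h / sig + - 1 / sig * w = (h - w) / sig" for w
    by (simp add: diff_divide_distrib)
  have **: "h - sig * ((h - w) / sig) = w" for w
    using assms by simp
  show ?thesis
    unfolding H_weight_def
    by (subst lborel_integral_real_affine[of "-1 / sig" _ "h / sig"])
      (use assms in \<open>simp_all only: * **, simp_all add: mult.assoc\<close>)
qed

text \<open>The Gaussian Taylor bound is integrated against the law of \<open>SY\<close>. This is
  Tweedie's formula: the derivative of the density is \<open>- 1 / sig\<close> times the density
  times \<open>E[G | H = h]\<close>.\<close>

lemma H_weight_DERIV:
  assumes eps: "0 \<le> eps" "eps \<le> 1 / 2" and sig: "sig \<noteq> 0"
  shows "(H_weight eps sig (\<lambda>_. 1) has_real_derivative - H_weight eps sig (\<lambda>g. g) h / sig) (at h)"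
proof (rule DERIV_from_quadratic_bound)
  fix y
  let ?r = "SY_density eps"
  let ?n = "\<lambda>h w. std_normal_density ((h - w) / sig)"
  note nonneg = SY_density_bounds(1)[OF eps]
  have int_r: "integrable lborel ?r"
    using SY_density_moment_integrable[OF eps, of 0] by simp
  have int_bounded: "integrable lborel (\<lambda>w. k w * ?r w)"
    if "k \<in> borel_measurable borel" "\<And>w. \<bar>k w\<bar> \<le> 1" for k
    by (rule Bochner_Integration.integrable_bound[OF int_r])
      (use that nonneg in \<open>auto intro!: mult_left_le_one_le simp: abs_mult\<close>)
  have int0: "integrable lborel (\<lambda>w. ?n h w * ?r w)" for h
    by (rule int_bounded) (auto simp: std_normal_density_le_1)
  have int1: "integrable lborel (\<lambda>w. (h - w) / sig * ?n h w * ?r w)"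
  proof (rule int_bounded)
    fix w
    \<comment> \<open>The square of \<open>\<bar>x\<bar> - 1\<close> gives
      \<open>\<bar>x\<bar> \<le> 1 + x^2 / 2\<close>.\<close>
    have "\<bar>x\<bar> * std_normal_density x \<le> (1 + x\<^sup>2 / 2) * std_normal_density x" for x
      using zero_le_power2[of "\<bar>x\<bar> - 1"]
      by (intro mult_right_mono) (auto simp: power2_eq_square algebra_simps)
    from order_trans[OF this quadratic_std_normal_density_le, of "(h - w) / sig"]
    show "\<bar>(h - w) / sig * ?n h w\<bar> \<le> 1"
      by (simp add: abs_mult)
  qed measurable
  \<comment> \<open>The Taylor remainder at \<open>(h - w) / sig\<close> for the increment
    \<open>(y - h) / sig\<close>, weighted by the law of \<open>SY\<close>.\<close>
  let ?e = "\<lambda>w. ?n y w * ?r w - ?n h w * ?r w + (y - h) / sig * ((h - w) / sig * ?n h w * ?r w)"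
  have eq: "H_weight eps sig (\<lambda>_. 1) y - H_weight eps sig (\<lambda>_. 1) h - (- H_weight eps sig (\<lambda>g. g) h / sig) * (y - h)
      = (LINT w|lborel. ?e w) / \<bar>sig\<bar>"
  proof -
    define A where "A h = (LINT w|lborel. ?n h w * ?r w)" for h
    define D where "D = (LINT w|lborel. (h - w) / sig * ?n h w * ?r w)"
    have e: "(LINT w|lborel. ?e w) = A y - A h + (y - h) / sig * D"
      unfolding A_def D_def
      by (simp only: Bochner_Integration.integral_add Bochner_Integration.integral_diff
          integral_mult_right_zero Bochner_Integration.integrable_diff integrable_mult_right int0 int1)
    have HA: "H_weight eps sig (\<lambda>_. 1) h = A h / \<bar>sig\<bar>" for h
      unfolding H_weight_convolution[OF sig] by (simp add: A_def)
    have HD: "H_weight eps sig (\<lambda>g. g) h = D / \<bar>sig\<bar>"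
      unfolding H_weight_convolution[OF sig] by (simp add: D_def)
    show ?thesis
      unfolding e HA HD using sig by (simp add: field_simps)
  qed
  have e_bound: "\<bar>?e w\<bar> \<le> 2 * ((y - h) / sig)\<^sup>2 * ?r w" for w
  proof -
    have d: "(y - w) / sig - (h - w) / sig = (y - h) / sig"
      by (simp add: diff_divide_distrib)
    have "?e w = (?n y w - ?n h w + (h - w) / sig * ?n h w * ((y - h) / sig)) * ?r w"
      by (simp add: algebra_simps)
    then have "\<bar>?e w\<bar> = \<bar>?n y w - ?n h w + (h - w) / sig * ?n h w * ((y - h) / sig)\<bar> * ?r w"
      using nonneg[of w] by (simp only: abs_mult abs_of_nonneg)
    also have "\<dots> \<le> 2 * ((y - h) / sig)\<^sup>2 * ?r w"
      using std_normal_density_taylor[of "(y - w) / sig" "(h - w) / sig"] nonneg[of w]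
      unfolding d by (rule mult_right_mono)
    finally show ?thesis .
  qed
  have "\<bar>LINT w|lborel. ?e w\<bar> \<le> (LINT w|lborel. \<bar>?e w\<bar>)"
    by (rule integral_abs_bound)
  also have "\<dots> \<le> (LINT w|lborel. 2 * ((y - h) / sig)\<^sup>2 * ?r w)"
    using int_r int0 int1
    by (intro integral_mono e_bound integrable_abs Bochner_Integration.integrable_add
        Bochner_Integration.integrable_diff integrable_mult_right) auto
  finally have "\<bar>LINT w|lborel. ?e w\<bar> / \<bar>sig\<bar> \<le> (2 * ((y - h) / sig)\<^sup>2 * integral\<^sup>L lborel ?r) / \<bar>sig\<bar>"
    by (intro divide_right_mono) auto
  then show "\<bar>H_weight eps sig (\<lambda>_. 1) y - H_weight eps sig (\<lambda>_. 1) h - (- H_weight eps sig (\<lambda>g. g) h / sig) * (y - h)\<bar>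
      \<le> (2 * integral\<^sup>L lborel ?r / (sig\<^sup>2 * \<bar>sig\<bar>)) * (y - h)\<^sup>2"
    unfolding eq by (simp add: field_simps)
qed

section \<open>Uniqueness of the density of \<open>H\<close>\<close>

text \<open>The set where the functions differ is open and null, hence empty.\<close>

lemma continuous_AE_eq_imp_eq:
  fixes f g :: "real \<Rightarrow> real"
  assumes "continuous_on UNIV f" "continuous_on UNIV g" "AE x in lborel. f x = g x"
  shows "f = g"
proof (rule ccontr)
  let ?S = "{x. f x \<noteq> g x}"
  assume "f \<noteq> g"
  then have "?S \<noteq> {}" by auto
  moreover have "open ?S" using assms by (intro open_Collect_neq)
  moreover from this have "?S \<in> null_sets lborel"
    using assms(3) by (subst AE_iff_null_sets) auto
  then have "negligible ?S"
    by (simp add: negligible_iff_null_sets null_sets_completionI)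
  ultimately show False using open_not_negligible by blast
qed

text \<open>Links the Tonelli form to the Bochner form of the density; boundedness of
  \<open>SY_density\<close> keeps the Bochner integral from falling back to its default
  \<open>0\<close>.\<close>

lemma H_density_nn:
  assumes eps: "0 \<le> eps" "eps \<le> 1 / 2"
  shows "(\<integral>\<^sup>+g. ennreal (std_normal_density g * SY_density eps (h - sig * g)) \<partial>lborel)
      = ennreal (H_weight eps sig (\<lambda>_. 1) h)"
proof -
  have "integrable lborel (\<lambda>g. std_normal_density g * SY_density eps (h - sig * g))"
  proof (rule Bochner_Integration.integrable_bound)
    show "integrable lborel (\<lambda>g. 2 * std_normal_density g)"
      using integrable_std_normal_moment[of 0] by simp
    have "SY_density eps w \<le> 2" for w
      using SY_density_bounds(2)[OF eps, of w] std_normal_density_le_1[of w] by linarith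
    then show "AE g in lborel. norm (std_normal_density g * SY_density eps (h - sig * g)) \<le> norm (2 * std_normal_density g)"
      using SY_density_bounds(1)[OF eps]
      by (intro AE_I2) (simp add: abs_mult mult.commute[of 2] mult_left_mono)
  qed measurable
  then show ?thesis
    using SY_density_bounds(1)[OF eps] by (simp add: H_weight_def nn_integral_eq_integral)
qed

text \<open>Both densities define the same measure, so they agree almost everywhere, and by
  continuity everywhere. Only then is \<open>deriv p\<close> determined pointwise.\<close>

lemma density_H_unique:
  assumes eps: "0 \<le> eps" "eps \<le> 1 / 2" and sig: "sig \<noteq> 0"
    and dens: "is_density_H eps sig p" and cont: "continuous_on UNIV p"
  shows "p = H_weight eps sig (\<lambda>_. 1)"
proof -
  let ?q = "H_weight eps sig (\<lambda>_. 1)"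
  have cont_q: "continuous_on UNIV ?q"
    using H_weight_DERIV[OF eps sig] by (meson DERIV_isCont continuous_at_imp_continuous_on)
  have [measurable]: "p \<in> borel_measurable borel" "?q \<in> borel_measurable borel"
    using cont cont_q by (auto intro: borel_measurable_continuous_onI)
  have p: "0 \<le> p h" for h
    using dens by (simp add: is_density_H_def)
  have q: "0 \<le> ?q h" for h
    unfolding H_weight_def using SY_density_bounds(1)[OF eps] by (intro integral_nonneg_AE) auto
  have ind: "integrable lborel (\<lambda>h. indicator A h * ?q h)"
      "(LINT h:A|lborel. p h) = (LINT h|lborel. indicator A h * ?q h)" if [measurable]: "A \<in> sets borel" for A
  proof -
    have growth: "\<bar>1 * indicator A (sig * g + w)\<bar> \<le> 1 * (1 + g\<^sup>2 + w\<^sup>2)" for g w :: real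
      by (auto simp: indicator_def)
    have meas: "(\<lambda>_. 1) \<in> borel_measurable borel" "(indicator A :: real \<Rightarrow> real) \<in> borel_measurable borel"
      by measurable
    note * = H_expectation[OF eps meas growth]
    show "integrable lborel (\<lambda>h. indicator A h * ?q h)" by (rule *(1))
    have "(LINT h:A|lborel. p h) = E_GSY eps (\<lambda>g s y. indicator A (sig * g + s * y))"
      using dens that by (simp add: is_density_H_def)
    then show "(LINT h:A|lborel. p h) = (LINT h|lborel. indicator A h * ?q h)"
      using *(2) by simp
  qed
  \<comment> \<open>A non-integrable \<open>p\<close> would have Bochner integral \<open>0\<close>,
    while the total mass is \<open>1\<close>.\<close>
  have int_p: "integrable lborel p"
  proof (rule ccontr)
    assume "\<not> integrable lborel p"
    then have "(LINT h:UNIV|lborel. p h) = 0"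
      by (simp add: set_lebesgue_integral_def not_integrable_integral_eq)
    moreover have "(LINT h:UNIV|lborel. p h) = E_GSY eps (\<lambda>g s y. indicator UNIV (sig * g + s * y))"
      using dens unfolding is_density_H_def by (metis sets.top space_borel)
    moreover have "E_GSY eps (\<lambda>g s y. indicator UNIV (sig * g + s * y)) = 1"
      using integral_std_normal_moment_even[of 0] by (simp add: E_GSY_def)
    ultimately show False by simp
  qed
  have "density lborel p = density lborel ?q"
  proof (rule measure_eqI)
    fix A assume "A \<in> sets (density lborel p)"
    then have A [measurable]: "A \<in> sets borel" by simp
    have "emeasure (density lborel p) A = (\<integral>\<^sup>+h. ennreal (indicator A h * p h) \<partial>lborel)"
      by (auto simp: emeasure_density intro!: nn_integral_cong split: split_indicator)
    also have "\<dots> = ennreal (LINT h|lborel. indicator A h * p h)"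
      using p integrable_mult_indicator[OF _ int_p, of A] by (intro nn_integral_eq_integral) auto
    also have "\<dots> = ennreal (LINT h|lborel. indicator A h * ?q h)"
      using ind(2)[OF A] by (simp add: set_lebesgue_integral_def)
    also have "\<dots> = (\<integral>\<^sup>+h. ennreal (indicator A h * ?q h) \<partial>lborel)"
      using q ind(1)[OF A] by (intro nn_integral_eq_integral[symmetric]) auto
    also have "\<dots> = emeasure (density lborel ?q) A"
      by (auto simp: emeasure_density intro!: nn_integral_cong split: split_indicator)
    finally show "emeasure (density lborel p) A = emeasure (density lborel ?q) A" .
  qed simp
  then have "AE h in lborel. ennreal (p h) = ennreal (?q h)"
    by (intro sigma_finite_measure.density_unique[OF sigma_finite_lborel]) auto
  then have "AE h in lborel. p h = ?q h"
    using p q by simp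
  then show ?thesis
    by (rule continuous_AE_eq_imp_eq[OF cont cont_q])
qed

section \<open>Cauchy-Schwarz for the envelope derivative against the score of
  \<open>H\<close>\<close>

theorem theorem2:
  fixes l :: "real \<Rightarrow> real" and eps delta mu alpha lam :: real and p :: "real \<Rightarrow> real"
  assumes convex: "convex_on UNIV l"
    and C1: "\<exists>l'. continuous_on UNIV l' \<and> (\<forall>x. (l has_real_derivative l' x) (at x))"
    and eps: "0 \<le> eps" "eps \<le> 1/2"
    and delta: "delta > 1"
    and sol: "alpha > 0" "lam > 0" "system_eqs l eps delta mu alpha lam"
    and uniq: "\<And>mu' alpha' lam'. alpha' > 0 \<Longrightarrow> lam' > 0 \<Longrightarrow> system_eqs l eps delta mu' alpha' lam'
                 \<Longrightarrow> mu' = mu \<and> alpha' = alpha \<and> lam' = lam"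
    and mu: "mu \<noteq> 0"
    and dens: "is_density_H eps (alpha / mu) p"
    and pdiff: "\<forall>h. p differentiable at h"
  shows "ennreal ((alpha / mu)^2) * fisher_H eps (alpha / mu) p \<ge> ennreal (1 / delta)"
proof -
  define sig where "sig = alpha / mu"
  have sig: "sig \<noteq> 0" using sol mu by (simp add: sig_def)
  define d where "d = moreau_d1 l lam"
  define F where "F h = d (mu * h)" for h
  have lip: "(1 / lam)-lipschitz_on UNIV d"
    unfolding d_def by (rule moreau_d1_lipschitz[OF convex C1 \<open>lam > 0\<close>])
  have cont_F: "continuous_on UNIV F"
    unfolding F_def
    by (intro continuous_on_compose2[OF lipschitz_on_continuous_on[OF lip]] continuous_intros) auto
  have [measurable]: "F \<in> borel_measurable borel"
    by (rule borel_measurable_continuous_onI[OF cont_F])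
  \<comment> \<open>Lipschitz continuity gives linear growth of \<open>F\<close>, hence the
    quadratic growth of \<open>F^2\<close> and \<open>g * F\<close> required for Fubini.\<close>
  obtain B where B: "0 \<le> B" "\<And>g w. \<bar>F (sig * g + w)\<bar> \<le> B * (1 + \<bar>g\<bar> + \<bar>w\<bar>)"
  proof
    let ?B = "\<bar>d 0\<bar> + \<bar>mu\<bar> / lam * \<bar>sig\<bar> + \<bar>mu\<bar> / lam"
    show "0 \<le> ?B" using \<open>lam > 0\<close> by simp
    fix g w
    have "\<bar>F (sig * g + w) - d 0\<bar> \<le> 1 / lam * \<bar>mu * (sig * g + w)\<bar>"
      using lipschitz_onD[OF lip, of "mu * (sig * g + w)" 0] by (simp add: F_def dist_real_def)
    also have "\<dots> = \<bar>mu\<bar> / lam * \<bar>sig * g + w\<bar>"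
      by (simp add: abs_mult)
    also have "\<dots> \<le> \<bar>mu\<bar> / lam * (\<bar>sig\<bar> * \<bar>g\<bar> + \<bar>w\<bar>)"
      using \<open>lam > 0\<close> by (intro mult_left_mono) (auto simp flip: abs_mult)
    finally have 1: "\<bar>F (sig * g + w)\<bar> \<le> \<bar>d 0\<bar> + \<bar>mu\<bar> / lam * \<bar>sig\<bar> * \<bar>g\<bar> + \<bar>mu\<bar> / lam * \<bar>w\<bar>"
      by (simp only: distrib_left mult.assoc) linarith
    have 2: "\<bar>d 0\<bar> \<le> ?B" "\<bar>mu\<bar> / lam * \<bar>sig\<bar> \<le> ?B" "\<bar>mu\<bar> / lam \<le> ?B"
      using \<open>lam > 0\<close> by auto
    have "\<bar>F (sig * g + w)\<bar> \<le> ?B + ?B * \<bar>g\<bar> + ?B * \<bar>w\<bar>"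
      by (rule order_trans[OF 1]) (intro add_mono mult_right_mono 2 abs_ge_zero)
    then show "\<bar>F (sig * g + w)\<bar> \<le> ?B * (1 + \<bar>g\<bar> + \<bar>w\<bar>)"
      by (simp only: distrib_left mult_1_right)
  qed

  have arg: "alpha * g + mu * s * y = mu * (sig * g + s * y)" for g s y
    using mu by (simp add: sig_def algebra_simps)
  \<comment> \<open>The factor \<open>1\<close> stands for the weight \<open>c\<close> in
    \<open>H_expectation\<close>.\<close>
  have eq2: "lam\<^sup>2 * delta * E_GSY eps (\<lambda>g s y. 1 * (F (sig * g + s * y))\<^sup>2) = alpha\<^sup>2"
    and eq3: "lam * delta * E_GSY eps (\<lambda>g s y. g * F (sig * g + s * y)) = alpha"
    using sol(3) by (simp_all add: system_eqs_def arg F_def d_def)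

  \<comment> \<open>The difference of the two sides is the sum of the three squares
    supplied.\<close>
  have square_sum: "(1 + \<bar>g\<bar> + \<bar>w\<bar>)\<^sup>2 \<le> 3 * (1 + g\<^sup>2 + w\<^sup>2)" for g w :: real
    using zero_le_power2[of "\<bar>g\<bar> - 1"] zero_le_power2[of "\<bar>w\<bar> - 1"] zero_le_power2[of "\<bar>g\<bar> - \<bar>w\<bar>"]
    by (simp add: power2_eq_square algebra_simps)
  have growth2: "\<bar>1 * (F (sig * g + w))\<^sup>2\<bar> \<le> (3 * B\<^sup>2) * (1 + g\<^sup>2 + w\<^sup>2)" for g w
  proof -
    have "(F (sig * g + w))\<^sup>2 \<le> (B * (1 + \<bar>g\<bar> + \<bar>w\<bar>))\<^sup>2"
      using power_mono[OF B(2)[of g w], of 2] by simp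
    also have "\<dots> \<le> B\<^sup>2 * (3 * (1 + g\<^sup>2 + w\<^sup>2))"
      unfolding power_mult_distrib by (intro mult_left_mono square_sum) auto
    finally show ?thesis by (simp add: algebra_simps)
  qed
  have growth3: "\<bar>g * F (sig * g + w)\<bar> \<le> (3 * B) * (1 + g\<^sup>2 + w\<^sup>2)" for g w
  proof -
    have "\<bar>g * F (sig * g + w)\<bar> \<le> (1 + \<bar>g\<bar> + \<bar>w\<bar>) * (B * (1 + \<bar>g\<bar> + \<bar>w\<bar>))"
      unfolding abs_mult by (intro mult_mono B) auto
    also have "\<dots> = B * (1 + \<bar>g\<bar> + \<bar>w\<bar>)\<^sup>2" by (simp add: power2_eq_square)
    also have "\<dots> \<le> B * (3 * (1 + g\<^sup>2 + w\<^sup>2))"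
      by (intro mult_left_mono square_sum B)
    finally show ?thesis by (simp add: algebra_simps)
  qed

  have cont_p: "continuous_on UNIV p"
    using pdiff by (meson continuous_at_imp_continuous_on differentiable_imp_continuous_within)
  have p_eq: "p = H_weight eps sig (\<lambda>_. 1)"
    using density_H_unique[OF eps sig _ cont_p] dens by (simp add: sig_def)
  have p_nonneg: "0 \<le> p h" for h
    using dens by (simp add: is_density_H_def)
  have [measurable]: "p \<in> borel_measurable borel"
    by (rule borel_measurable_continuous_onI[OF cont_p])
  have deriv_p: "(p has_real_derivative - H_weight eps sig (\<lambda>g. g) h / sig) (at h)" for h
    unfolding p_eq by (rule H_weight_DERIV[OF eps sig])
  then have deriv_eq: "deriv p h = - H_weight eps sig (\<lambda>g. g) h / sig" for h
    by (rule DERIV_imp_deriv)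
  have [measurable]: "deriv p \<in> borel_measurable borel"
    unfolding deriv_eq H_weight_def by measurable
  \<comment> \<open>The score of \<open>H\<close>; its second moment under \<open>p\<close> is the
    Fisher information.\<close>
  define xi where "xi h = deriv p h / p h" for h
  have [measurable]: "xi \<in> borel_measurable borel"
    unfolding xi_def by measurable
  have xi_p: "xi h * p h = deriv p h" for h
  proof (cases "p h = 0")
    case True
    \<comment> \<open>Zeros of the density are minima, so the convention \<open>x / 0 = 0\<close> is harmless.\<close>
    then have "deriv p h = 0"
      unfolding deriv_eq using p_nonneg by (intro DERIV_local_min[OF deriv_p zero_less_one]) simp
    with True show ?thesis by simp
  qed (simp add: xi_def)

  have nnF: "(\<integral>\<^sup>+h. ennreal ((F h)\<^sup>2 * p h) \<partial>lborel) = ennreal (alpha\<^sup>2 / (lam\<^sup>2 * delta))"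
  proof -
    have meas: "(\<lambda>_. 1) \<in> borel_measurable borel" "(\<lambda>h. (F h)\<^sup>2) \<in> borel_measurable borel"
      by measurable
    note * = H_expectation[OF eps meas growth2, folded p_eq]
    have "(LINT h|lborel. (F h)\<^sup>2 * p h) = alpha\<^sup>2 / (lam\<^sup>2 * delta)"
      using eq2 sol delta unfolding *(2) by (simp add: field_simps)
    then show ?thesis
      using *(1) p_nonneg by (simp add: nn_integral_eq_integral)
  qed

  have nnxi: "(\<integral>\<^sup>+h. ennreal ((xi h)\<^sup>2 * p h) \<partial>lborel) = fisher_H eps sig p"
    using En_GSY_H[OF eps, of "\<lambda>h. (xi h)\<^sup>2" sig, unfolded H_density_nn[OF eps], folded p_eq]
    by (simp add: fisher_H_def xi_def ennreal_mult')

  \<comment> \<open>Gaussian integration by parts, obtained by conditioning on \<open>H\<close> and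
    inserting Tweedie's formula.\<close>
  have stein: "alpha / (lam * delta) = - sig * (LINT h|lborel. F h * deriv p h)"
  proof -
    have meas: "(\<lambda>g. g :: real) \<in> borel_measurable borel" by measurable
    have "alpha / (lam * delta) = E_GSY eps (\<lambda>g s y. g * F (sig * g + s * y))"
      using eq3 sol delta by (simp add: field_simps)
    also have "\<dots> = (LINT h|lborel. F h * H_weight eps sig (\<lambda>g. g) h)"
      by (rule H_expectation(2)[OF eps meas _ growth3]) measurable
    also have "\<dots> = (LINT h|lborel. - sig * (F h * deriv p h))"
      using sig by (simp add: deriv_eq)
    finally show ?thesis by simp
  qed

  \<comment> \<open>\<open>sig\<close> has the sign of \<open>mu\<close>, hence the absolute
    values.\<close>
  have "ennreal (alpha / (lam * delta)) \<le> ennreal \<bar>sig\<bar> * ennreal \<bar>LINT h|lborel. F h * deriv p h\<bar>"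
    unfolding stein by (simp add: ennreal_leI abs_ge_minus_self flip: ennreal_mult' abs_mult)
  \<comment> \<open>If the integrand is not integrable, the Bochner integral is \<open>0\<close> and
    the inequality is trivial.\<close>
  also have "\<dots> \<le> ennreal \<bar>sig\<bar> * (\<integral>\<^sup>+h. ennreal \<bar>F h * deriv p h\<bar> \<partial>lborel)"
    using integral_norm_bound_ennreal[of lborel "\<lambda>h. F h * deriv p h"]
    by (cases "integrable lborel (\<lambda>h. F h * deriv p h)")
      (auto intro!: mult_left_mono simp: not_integrable_integral_eq)
  \<comment> \<open>The weight \<open>p\<close> is shared as \<open>sqrt p * sqrt p\<close> between
    the two factors of Cauchy-Schwarz.\<close>
  also have "\<dots> = ennreal \<bar>sig\<bar> *
      (\<integral>\<^sup>+h. ennreal (\<bar>F h\<bar> * sqrt (p h)) * ennreal (\<bar>xi h\<bar> * sqrt (p h)) \<partial>lborel)"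
    using p_nonneg
    by (simp add: abs_mult mult_ac flip: xi_p ennreal_mult')
  finally have "(ennreal (alpha / (lam * delta)))\<^sup>2 \<le> (ennreal \<bar>sig\<bar>)\<^sup>2 *
      (\<integral>\<^sup>+h. ennreal (\<bar>F h\<bar> * sqrt (p h)) * ennreal (\<bar>xi h\<bar> * sqrt (p h)) \<partial>lborel)\<^sup>2"
    by (simp add: power_mono flip: power_mult_distrib)
  also have "\<dots> \<le> (ennreal \<bar>sig\<bar>)\<^sup>2 * ((\<integral>\<^sup>+h. ennreal (\<bar>F h\<bar> * sqrt (p h)) ^ 2 \<partial>lborel) *
      (\<integral>\<^sup>+h. ennreal (\<bar>xi h\<bar> * sqrt (p h)) ^ 2 \<partial>lborel))"
    by (intro mult_left_mono Cauchy_Schwarz_nn_integral) auto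
  also have "\<dots> = ennreal (sig\<^sup>2) * (ennreal (alpha\<^sup>2 / (lam\<^sup>2 * delta)) * fisher_H eps sig p)"
    using p_nonneg by (simp add: ennreal_power power_mult_distrib nnF nnxi)
  finally have main: "ennreal ((alpha / (lam * delta))\<^sup>2) \<le>
      ennreal (alpha\<^sup>2 / (lam\<^sup>2 * delta)) * (ennreal (sig\<^sup>2) * fisher_H eps sig p)"
    using sol delta by (simp add: ennreal_power mult_ac)
  \<comment> \<open>Multiplying \<open>main\<close> by the reciprocal of the second moment of
    \<open>F(H)\<close> turns its left side into \<open>1 / delta\<close>.\<close>
  have "ennreal (1 / delta) = ennreal (lam\<^sup>2 * delta / alpha\<^sup>2) * ennreal ((alpha / (lam * delta))\<^sup>2)"
    using sol delta by (simp add: field_simps power2_eq_square flip: ennreal_mult')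
  also have "\<dots> \<le> ennreal (lam\<^sup>2 * delta / alpha\<^sup>2) *
      (ennreal (alpha\<^sup>2 / (lam\<^sup>2 * delta)) * (ennreal (sig\<^sup>2) * fisher_H eps sig p))"
    by (intro mult_left_mono main) simp
  also have "\<dots> = ennreal (lam\<^sup>2 * delta / alpha\<^sup>2 * (alpha\<^sup>2 / (lam\<^sup>2 * delta))) * (ennreal (sig\<^sup>2) * fisher_H eps sig p)"
    using sol delta by (subst ennreal_mult) (auto simp: mult.assoc)
  also have "\<dots> = ennreal (sig\<^sup>2) * fisher_H eps sig p"
    using sol delta by simp
  finally show ?thesis by (simp add: sig_def)
qed

end
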